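(* Let $\mathcal{P}=kan\langle \Gamma\mid\Delta\mid RelB\mid X\mid F\rangle$ be a Kan extension presentation of the Kan extension $(K,\varepsilon)$, with $\Gamma,\Delta$ finite graphs and each $XA$ finite, and let $\mathcal{R}=(\mathcal{R}_T,\mathcal{R}_P)$ be a finite complete rewrite system on $T$ for $(K,\varepsilon)$ (with respect to a short-lex ordering on $\Sigma$). Let $\Sigma:=(\sqcup XA)\sqcup\mathrm{Arr}\,\Delta$. Then for each object $B\in\mathrm{Ob}\,\Delta$ there is a regular expression representing a regular language $K_B$ over $\Sigma$ such that (i) $KB=\{[t]_{\mathcal{R}} : t\in K_B\}$, where $[t]_{\mathcal{R}}$ is the equivalence class of $t$ in $T$ under $\stackrel{*}{\leftrightarrow}_{\mathcal{R}}$; (ii) for every arrow $b:B_1\to B_2$ in $\mathrm{Arr}\,\Delta$ and every $t\in K_{B_1}$, the term $\mathsf{irr}(t\cdot b)$ is an element of $K_{B_2}$.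
   Context: A Kan extension presentation $kan\langle\Gamma\mid\Delta\mid RelB\mid X\mid F\rangle$ consists of directed graphs $\Gamma,\Delta$, graph morphisms $X:\Gamma\to\mathsf{Sets}$ and $F:\Gamma\to\mathsf{P}$ ($\mathsf{P}$ the free category on $\Delta$), and $RelB\subseteq\mathrm{Arr}\,\mathsf{P}\times\mathrm{Arr}\,\mathsf{P}$; $X$ extends to an action $x\mapsto x\cdot a$ of the category $\mathsf{A}$ generated by $\Gamma$, and $F$ induces a functor $\mathsf{A}\to\mathsf{B}$, where $\mathsf{B}$ is presented by $cat\langle\Delta\mid RelB\rangle$. The Kan extension $(K,\varepsilon)$ is the universal pair of a functor $K:\mathsf{B}\to\mathsf{Sets}$ and natural transformation $\varepsilon:X\to K\circ F$. Terms: $T=\{x\mid p: x\in XA,\ p:FA\to B \text{ in } \mathsf{P},\ A\in\mathrm{Ob}\,\Gamma,\ B\in\mathrm{Ob}\,\Delta\}$, regarded as words $x b_1\cdots b_n\in\Sigma^*$ when $p=b_1\cdots b_n$; $\tau(x\mid p)$ is the target of $p$ (or $FA$ if $p=\mathrm{id}_{FA}$), $T_B=\{t\in T:\tau(t)=B\}$, and $\mathsf{P}$ acts on $T$ by $(x\mid p)\cdot q=x\mid pq$ when defined. A rewrite system $\mathcal{R}=(\mathcal{R}_T,\mathcal{R}_P)$ on $T$ consists of rules $\mathcal{R}_T\subseteq T\times T$ and $\mathcal{R}_P\subseteq\mathrm{Arr}\,\mathsf{P}\times\mathrm{Arr}\,\mathsf{P}$, giving the reduction relation $(x\mid u)\cdot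 w\to (y\mid v)\cdot w$ for $(x\mid u,\,y\mid v)\in\mathcal{R}_T$, and $x\mid ulw\to x\mid urw$ for $(l,r)\in\mathcal{R}_P$; $\stackrel{*}{\leftrightarrow}_{\mathcal{R}}$ is the generated equivalence. $\mathcal{R}$ is a rewrite system for $(K,\varepsilon)$ if $\stackrel{*}{\leftrightarrow}_{\mathcal{R}}$ equals the equivalence generated by the rules $x\mid Fa\to x\cdot a\mid \mathrm{id}$ ($x\in XA_1$, $a:A_1\to A_2$ in $\mathsf{A}$) and $RelB$; then $KB$ is identified with $T_B/\stackrel{*}{\leftrightarrow}_{\mathcal{R}}$, with $\mathsf{B}$ acting via the action of $\mathsf{P}$ on $T$. $\mathcal{R}$ is complete if the reduction relation is Noetherian and confluent (each class contains a unique irreducible term); $\mathsf{irr}(t)$ denotes the irreducible form of $t$. It is finite if it has finitely many rules. *)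

theory Defs
  imports "Graph_Theory.Arc_Walk" "HOL-Library.Confluence" "HOL-Library.FuncSet"
begin

section \<open>Kan extension presentations\<close>

text \<open>
  An arrow of the free category on a digraph is a triple (source, list of arcs, target); the
  end points are recorded so that the identities at different objects are different arrows.
  Composition is written in diagrammatic order, so it is concatenation of the arc lists.
\<close>

type_synonym ('c, 'b) arrow = "'c \<times> 'b list \<times> 'c"

abbreviation src :: "('c, 'b) arrow \<Rightarrow> 'c" where "src \<equiv> fst"
abbreviation arr_path :: "('c, 'b) arrow \<Rightarrow> 'b list" where "arr_path p \<equiv> fst (snd p)"
abbreviation tgt :: "('c, 'b) arrow \<Rightarrow> 'c" where "tgt p \<equiv> snd (snd p)"

definition free_arrows :: "('c, 'b) pre_digraph \<Rightarrow> ('c, 'b) arrow set" where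
  "free_arrows G = {(u, p, v). pre_digraph.awalk G u p v}"

record ('o, 'a, 'c, 'b, 'x) kan_pres =
  Gam :: "('o, 'a) pre_digraph"
  Del :: "('c, 'b) pre_digraph"
  RelB :: "(('c, 'b) arrow \<times> ('c, 'b) arrow) set"
  Xob :: "'o \<Rightarrow> 'x set"
  Xarr :: "'a \<Rightarrow> 'x \<Rightarrow> 'x"
  Fob :: "'o \<Rightarrow> 'c"
  Farr :: "'a \<Rightarrow> 'b list"

text \<open>
  The pairs in RelB are parallel, as they must be to present a category.
\<close>

definition kan_presentation :: "('o, 'a, 'c, 'b, 'x) kan_pres \<Rightarrow> bool" where
  "kan_presentation P \<longleftrightarrow>
     wf_digraph (Gam P) \<and> wf_digraph (Del P) \<and>
     RelB P \<subseteq> free_arrows (Del P) \<times> free_arrows (Del P) \<and>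
     (\<forall>(l, r) \<in> RelB P. src l = src r \<and> tgt l = tgt r) \<and>
     (\<forall>a \<in> arcs (Gam P). Xarr P a \<in> Xob P (tail (Gam P) a) \<rightarrow> Xob P (head (Gam P) a)) \<and>
     (\<forall>A \<in> verts (Gam P). Fob P A \<in> verts (Del P)) \<and>
     (\<forall>a \<in> arcs (Gam P).
        pre_digraph.awalk (Del P) (Fob P (tail (Gam P) a)) (Farr P a) (Fob P (head (Gam P) a)))"

definition Xact :: "('o, 'a, 'c, 'b, 'x) kan_pres \<Rightarrow> 'x \<Rightarrow> 'a list \<Rightarrow> 'x" where
  "Xact P x a = fold (Xarr P) a x"

definition Fpath :: "('o, 'a, 'c, 'b, 'x) kan_pres \<Rightarrow> 'a list \<Rightarrow> 'b list" where
  "Fpath P a = concat (map (Farr P) a)"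


section \<open>The Kan extension\<close>

inductive relB_step ::
  "('o, 'a, 'c, 'b, 'x) kan_pres \<Rightarrow> ('c, 'b) arrow \<Rightarrow> ('c, 'b) arrow \<Rightarrow> bool" for P where
  "(l, r) \<in> RelB P \<Longrightarrow>
   pre_digraph.awalk (Del P) B u (src l) \<Longrightarrow> pre_digraph.awalk (Del P) (tgt l) w C \<Longrightarrow>
   relB_step P (B, u @ arr_path l @ w, C) (B, u @ arr_path r @ w, C)"

text \<open>
  The arrow of the presented category cat(Del | RelB) represented by an arrow of the free
  category on Del. Its objects are the vertices of Del.
\<close>

definition Barr :: "('o, 'a, 'c, 'b, 'x) kan_pres \<Rightarrow> ('c, 'b) arrow \<Rightarrow> ('c, 'b) arrow set" where
  "Barr P p = {q \<in> free_arrows (Del P). equivclp (relB_step P) p q}"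

definition set_functor ::
  "('o, 'a, 'c, 'b, 'x) kan_pres \<Rightarrow> ('c \<Rightarrow> 'k set) \<Rightarrow> (('c, 'b) arrow set \<Rightarrow> 'k \<Rightarrow> 'k) \<Rightarrow> bool" where
  "set_functor P K K' \<longleftrightarrow>
     (\<forall>p \<in> free_arrows (Del P). K' (Barr P p) \<in> K (src p) \<rightarrow> K (tgt p)) \<and>
     (\<forall>B \<in> verts (Del P). \<forall>k \<in> K B. K' (Barr P (B, [], B)) k = k) \<and>
     (\<forall>B p C q D. (B, p, C) \<in> free_arrows (Del P) \<longrightarrow> (C, q, D) \<in> free_arrows (Del P) \<longrightarrow>
        (\<forall>k \<in> K B. K' (Barr P (B, p @ q, D)) k = K' (Barr P (C, q, D)) (K' (Barr P (B, p, C)) k)))"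

text \<open>Natural transformations from X to the composite of F with the functor (L, L').\<close>

definition nat_trans_X ::
  "('o, 'a, 'c, 'b, 'x) kan_pres \<Rightarrow> ('c \<Rightarrow> 'k set) \<Rightarrow> (('c, 'b) arrow set \<Rightarrow> 'k \<Rightarrow> 'k) \<Rightarrow>
   ('o \<Rightarrow> 'x \<Rightarrow> 'k) \<Rightarrow> bool" where
  "nat_trans_X P L L' \<eta> \<longleftrightarrow>
     (\<forall>A \<in> verts (Gam P). \<eta> A \<in> Xob P A \<rightarrow> L (Fob P A)) \<and>
     (\<forall>A1 a A2. pre_digraph.awalk (Gam P) A1 a A2 \<longrightarrow>
        (\<forall>x \<in> Xob P A1.
           \<eta> A2 (Xact P x a) = L' (Barr P (Fob P A1, Fpath P a, Fob P A2)) (\<eta> A1 x)))"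

text \<open>Natural transformations between functors from the presented category to sets.\<close>

definition nat_trans_B ::
  "('o, 'a, 'c, 'b, 'x) kan_pres \<Rightarrow> ('c \<Rightarrow> 'k set) \<Rightarrow> (('c, 'b) arrow set \<Rightarrow> 'k \<Rightarrow> 'k) \<Rightarrow>
   ('c \<Rightarrow> 'l set) \<Rightarrow> (('c, 'b) arrow set \<Rightarrow> 'l \<Rightarrow> 'l) \<Rightarrow> ('c \<Rightarrow> 'k \<Rightarrow> 'l) \<Rightarrow> bool" where
  "nat_trans_B P K K' L L' \<alpha> \<longleftrightarrow>
     (\<forall>B \<in> verts (Del P). \<alpha> B \<in> K B \<rightarrow> L B) \<and>
     (\<forall>p \<in> free_arrows (Del P). \<forall>k \<in> K (src p).
        \<alpha> (tgt p) (K' (Barr P p) k) = L' (Barr P p) (\<alpha> (src p) k))"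

definition factors_through ::
  "('o, 'a, 'c, 'b, 'x) kan_pres \<Rightarrow> ('o \<Rightarrow> 'x \<Rightarrow> 'k) \<Rightarrow> ('c \<Rightarrow> 'k \<Rightarrow> 'l) \<Rightarrow> ('o \<Rightarrow> 'x \<Rightarrow> 'l) \<Rightarrow> bool" where
  "factors_through P \<epsilon> \<alpha> \<eta> \<longleftrightarrow>
     (\<forall>A \<in> verts (Gam P). \<forall>x \<in> Xob P A. \<alpha> (Fob P A) (\<epsilon> A x) = \<eta> A x)"

text \<open>
  The universal property of the Kan extension. A definition in HOL can only quantify over
  functors with values in the sets of one type; that type is the first argument. A Kan
  extension satisfies this predicate for every choice of it.
\<close>

definition kan_extension ::
  "'l itself \<Rightarrow> ('o, 'a, 'c, 'b, 'x) kan_pres \<Rightarrow>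
   ('c \<Rightarrow> 'k set) \<Rightarrow> (('c, 'b) arrow set \<Rightarrow> 'k \<Rightarrow> 'k) \<Rightarrow> ('o \<Rightarrow> 'x \<Rightarrow> 'k) \<Rightarrow> bool" where
  "kan_extension _ P K K' \<epsilon> \<longleftrightarrow>
     set_functor P K K' \<and> nat_trans_X P K K' \<epsilon> \<and>
     (\<forall>(L :: 'c \<Rightarrow> 'l set) L' \<eta>. set_functor P L L' \<and> nat_trans_X P L L' \<eta> \<longrightarrow>
        (\<exists>\<alpha>. nat_trans_B P K K' L L' \<alpha> \<and> factors_through P \<epsilon> \<alpha> \<eta>) \<and>
        (\<forall>\<alpha> \<alpha>'. nat_trans_B P K K' L L' \<alpha> \<and> factors_through P \<epsilon> \<alpha> \<eta> \<and>
                nat_trans_B P K K' L L' \<alpha>' \<and> factors_through P \<epsilon> \<alpha>' \<eta> \<longrightarrow>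
                (\<forall>B \<in> verts (Del P). \<forall>k \<in> K B. \<alpha> B k = \<alpha>' B k)))"


section \<open>Terms\<close>

text \<open>
  Elements of the sets XA are tagged with A, so that their union is disjoint.
\<close>

type_synonym ('o, 'x, 'b) letter = "('o \<times> 'x) + 'b"

definition alphabet :: "('o, 'a, 'c, 'b, 'x) kan_pres \<Rightarrow> ('o, 'x, 'b) letter set" where
  "alphabet P = (SIGMA A : verts (Gam P). Xob P A) <+> arcs (Del P)"

definition kterm :: "'o \<Rightarrow> 'x \<Rightarrow> 'b list \<Rightarrow> ('o, 'x, 'b) letter list" where
  "kterm A x p = Inl (A, x) # map Inr p"

definition terms :: "('o, 'a, 'c, 'b, 'x) kan_pres \<Rightarrow> ('o, 'x, 'b) letter list set" where
  "terms P = {kterm A x p | A x p B.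
     A \<in> verts (Gam P) \<and> x \<in> Xob P A \<and> pre_digraph.awalk (Del P) (Fob P A) p B}"

definition tau :: "('o, 'a, 'c, 'b, 'x) kan_pres \<Rightarrow> ('o, 'x, 'b) letter list \<Rightarrow> 'c" where
  "tau P t = (if tl t = [] then Fob P (fst (projl (hd t))) else head (Del P) (projr (last t)))"

definition terms_at :: "('o, 'a, 'c, 'b, 'x) kan_pres \<Rightarrow> 'c \<Rightarrow> ('o, 'x, 'b) letter list set" where
  "terms_at P B = {t \<in> terms P. tau P t = B}"

text \<open>The partial action of paths on terms; it is defined only for paths starting at tau.\<close>

definition tact :: "('o, 'x, 'b) letter list \<Rightarrow> 'b list \<Rightarrow> ('o, 'x, 'b) letter list" where
  "tact t q = t @ map Inr q"


section \<open>Rewrite systems\<close>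

type_synonym ('o, 'c, 'b, 'x) rewr_sys =
  "(('o, 'x, 'b) letter list \<times> ('o, 'x, 'b) letter list) set \<times>
   (('c, 'b) arrow \<times> ('c, 'b) arrow) set"

definition rewrite_system ::
  "('o, 'a, 'c, 'b, 'x) kan_pres \<Rightarrow> ('o, 'c, 'b, 'x) rewr_sys \<Rightarrow> bool" where
  "rewrite_system P R \<longleftrightarrow>
     fst R \<subseteq> terms P \<times> terms P \<and> snd R \<subseteq> free_arrows (Del P) \<times> free_arrows (Del P)"

text \<open>
  The conditions that the two sides of a rule have the same end points say that the composites
  on both sides of the reduction are defined.
\<close>

inductive red ::
  "('o, 'a, 'c, 'b, 'x) kan_pres \<Rightarrow> ('o, 'c, 'b, 'x) rewr_sys \<Rightarrow>
   ('o, 'x, 'b) letter list \<Rightarrow> ('o, 'x, 'b) letter list \<Rightarrow> bool" for P R where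
  red_T: "(s, t) \<in> fst R \<Longrightarrow> s \<in> terms P \<Longrightarrow> t \<in> terms P \<Longrightarrow> tau P s = tau P t \<Longrightarrow>
    pre_digraph.awalk (Del P) (tau P s) w B \<Longrightarrow> red P R (tact s w) (tact t w)"
| red_P: "(l, r) \<in> snd R \<Longrightarrow> src l = src r \<Longrightarrow> tgt l = tgt r \<Longrightarrow>
    l \<in> free_arrows (Del P) \<Longrightarrow> r \<in> free_arrows (Del P) \<Longrightarrow>
    A \<in> verts (Gam P) \<Longrightarrow> x \<in> Xob P A \<Longrightarrow>
    pre_digraph.awalk (Del P) (Fob P A) u (src l) \<Longrightarrow> pre_digraph.awalk (Del P) (tgt l) w B \<Longrightarrow>
    red P R (kterm A x (u @ arr_path l @ w)) (kterm A x (u @ arr_path r @ w))"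

definition init_system ::
  "('o, 'a, 'c, 'b, 'x) kan_pres \<Rightarrow> ('o, 'c, 'b, 'x) rewr_sys" where
  "init_system P =
     ({(kterm A1 x (Fpath P a), kterm A2 (Xact P x a) []) | A1 a A2 x.
         pre_digraph.awalk (Gam P) A1 a A2 \<and> x \<in> Xob P A1},
      RelB P)"

definition rewrite_system_for ::
  "('o, 'a, 'c, 'b, 'x) kan_pres \<Rightarrow> ('o, 'c, 'b, 'x) rewr_sys \<Rightarrow> bool" where
  "rewrite_system_for P R \<longleftrightarrow>
     rewrite_system P R \<and> equivclp (red P R) = equivclp (red P (init_system P))"

definition complete_system ::
  "('o, 'a, 'c, 'b, 'x) kan_pres \<Rightarrow> ('o, 'c, 'b, 'x) rewr_sys \<Rightarrow> bool" where
  "complete_system P R \<longleftrightarrow> wfp (red P R)\<inverse>\<inverse> \<and> confluentp (red P R)"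

definition finite_system :: "('o, 'c, 'b, 'x) rewr_sys \<Rightarrow> bool" where
  "finite_system R \<longleftrightarrow> finite (fst R) \<and> finite (snd R)"

text \<open>Every rule decreases the short-lex order on words given by the linear order on letters.\<close>

definition short_lex_reducing ::
  "('o, 'x, 'b) letter rel \<Rightarrow> ('o, 'c, 'b, 'x) rewr_sys \<Rightarrow> bool" where
  "short_lex_reducing ord R \<longleftrightarrow>
     (\<forall>(s, t) \<in> fst R. (t, s) \<in> lenlex (ord - Id)) \<and>
     (\<forall>(l, r) \<in> snd R. (map Inr (arr_path r), map Inr (arr_path l)) \<in> lenlex (ord - Id))"

definition irr ::
  "('o, 'a, 'c, 'b, 'x) kan_pres \<Rightarrow> ('o, 'c, 'b, 'x) rewr_sys \<Rightarrow>
   ('o, 'x, 'b) letter list \<Rightarrow> ('o, 'x, 'b) letter list" where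
  "irr P R t = (THE s. (red P R)\<^sup>*\<^sup>* t s \<and> (\<nexists>u. red P R s u))"

definition term_rel ::
  "('o, 'a, 'c, 'b, 'x) kan_pres \<Rightarrow> ('o, 'c, 'b, 'x) rewr_sys \<Rightarrow> ('o, 'x, 'b) letter list rel" where
  "term_rel P R = {(s, t). s \<in> terms P \<and> t \<in> terms P \<and> equivclp (red P R) s t}"

definition term_class ::
  "('o, 'a, 'c, 'b, 'x) kan_pres \<Rightarrow> ('o, 'c, 'b, 'x) rewr_sys \<Rightarrow>
   ('o, 'x, 'b) letter list \<Rightarrow> ('o, 'x, 'b) letter list set" where
  "term_class P R t = term_rel P R `` {t}"

text \<open>
  The identification of KB with the quotient of the terms at B: the class of a term x|p
  corresponds to K(p) applied to \<open>\<epsilon>\<close>(x).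
\<close>

definition kan_identification ::
  "('o, 'a, 'c, 'b, 'x) kan_pres \<Rightarrow> ('o, 'c, 'b, 'x) rewr_sys \<Rightarrow>
   ('c \<Rightarrow> 'k set) \<Rightarrow> (('c, 'b) arrow set \<Rightarrow> 'k \<Rightarrow> 'k) \<Rightarrow> ('o \<Rightarrow> 'x \<Rightarrow> 'k) \<Rightarrow>
   (('o, 'x, 'b) letter list set \<Rightarrow> 'k) \<Rightarrow> bool" where
  "kan_identification P R K K' \<epsilon> \<theta> \<longleftrightarrow>
     (\<forall>B \<in> verts (Del P). bij_betw \<theta> (terms_at P B // term_rel P R) (K B)) \<and>
     (\<forall>A \<in> verts (Gam P). \<forall>x \<in> Xob P A. \<forall>p B. pre_digraph.awalk (Del P) (Fob P A) p B \<longrightarrow>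
        \<theta> (term_class P R (kterm A x p)) = K' (Barr P (Fob P A, p, B)) (\<epsilon> A x))"


section \<open>Regular expressions\<close>

datatype (atoms: 'a) rexp =
    Zero
  | One
  | Atom 'a
  | Plus "'a rexp" "'a rexp"
  | Times "'a rexp" "'a rexp"
  | Star "'a rexp"

primrec lang :: "'a rexp \<Rightarrow> 'a list set" where
  "lang Zero = {}"
| "lang One = {[]}"
| "lang (Atom a) = {[a]}"
| "lang (Plus r s) = lang r \<union> lang s"
| "lang (Times r s) = {u @ v | u v. u \<in> lang r \<and> v \<in> lang s}"
| "lang (Star r) = {concat ws | ws. set ws \<subseteq> lang r}"

end

(*
  The irreducible terms at B represent each class exactly once. How an irreducible term of
  length above n can be continued depends only on its last n letters, where n
  bounds the left hand sides of the rules. So the language of irreducible terms has finitely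
  many left quotients, and solving the resulting linear system by Arden's rule gives a regular
  expression. To identify KB with the classes of terms at B, send x|p to K(p)(\<epsilon>(x)). The
  universal property yields a map from K to the quotient functor that is left inverse to this;
  surjectivity follows by comparing two maps into a functor of sieves.
*)
theory Submission
  imports Defs "HOL-Library.Sublist"
begin

section \<open>Regular languages and left quotients\<close>

text \<open>The shape of the identification proof comes from one restriction: the universal property
  may be tested only on functors whose values are sets of words. The functor of classes of terms is
  of this kind, so the existence half gives injectivity directly. For surjectivity the natural test
  objects would be built from the image subfunctor inside \<open>K\<close>, but their elements live
  in the type of \<open>K\<close>. A sieve, in contrast, is a set of paths and hence a set of words,
  so a subset of \<open>K\<close> can be classified within the permitted type, and the uniqueness
  half applies. On the language side, redexes must be recognisable from letters alone, although
  arrows carry end points that words do not. A nonempty list of arcs determines its end points, and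
  short-lex reduction forbids an empty left hand side of a path rule. Hence an occurrence of the
  letters of a left hand side in a term is a genuine redex.\<close>

definition regular :: "'a set \<Rightarrow> 'a list set \<Rightarrow> bool" where
  "regular S L \<longleftrightarrow> (\<exists>r. atoms r \<subseteq> S \<and> lang r = L)"

definition conc :: "'a list set \<Rightarrow> 'a list set \<Rightarrow> 'a list set" where
  "conc A B = {u @ v | u v. u \<in> A \<and> v \<in> B}"

definition star :: "'a list set \<Rightarrow> 'a list set" where
  "star A = {concat ws | ws. set ws \<subseteq> A}"

lemma concI: "u \<in> A \<Longrightarrow> v \<in> B \<Longrightarrow> u @ v \<in> conc A B"
  by (auto simp: conc_def)

lemma concE:
  assumes "w \<in> conc A B" obtains u v where "w = u @ v" "u \<in> A" "v \<in> B"
  using assms by (auto simp: conc_def)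

lemma Cons_in_conc_letters: "a # w \<in> conc (\<Union>b\<in>T. {[b]}) A \<longleftrightarrow> a \<in> T \<and> w \<in> A"
  using concI[of "[a]" "\<Union>b\<in>T. {[b]}" w A] by (auto elim!: concE)

lemma conc_assoc: "conc (conc A B) C = conc A (conc B C)"
proof (intro set_eqI iffI)
  fix w assume "w \<in> conc (conc A B) C"
  then obtain u v z where "w = (u @ v) @ z" "u \<in> A" "v \<in> B" "z \<in> C"
    by (auto elim!: concE)
  then show "w \<in> conc A (conc B C)"
    by (simp add: concI)
next
  fix w assume "w \<in> conc A (conc B C)"
  then obtain u v z where "w = u @ (v @ z)" "u \<in> A" "v \<in> B" "z \<in> C"
    by (auto elim!: concE)
  then show "w \<in> conc (conc A B) C"
    using concI[OF concI] by fastforce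
qed

lemma conc_Un_left: "conc (A \<union> B) C = conc A C \<union> conc B C"
  and conc_Un_right: "conc C (A \<union> B) = conc C A \<union> conc C B"
  and conc_UN_right: "conc C (\<Union>i\<in>I. F i) = (\<Union>i\<in>I. conc C (F i))"
  by (auto simp: conc_def)

lemma regular_empty: "regular S {}"
  unfolding regular_def by (rule exI[of _ Zero]) simp

lemma regular_Nil: "regular S {[]}"
  unfolding regular_def by (rule exI[of _ One]) simp

lemma regular_letter: "a \<in> S \<Longrightarrow> regular S {[a]}"
  unfolding regular_def by (rule exI[of _ "Atom a"]) simp

lemma regular_Un: "regular S A \<Longrightarrow> regular S B \<Longrightarrow> regular S (A \<union> B)"
  unfolding regular_def by (elim exE conjE, rule_tac x = "Plus r ra" in exI) auto

lemma regular_conc: "regular S A \<Longrightarrow> regular S B \<Longrightarrow> regular S (conc A B)"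
  unfolding regular_def conc_def by (elim exE conjE, rule_tac x = "Times r ra" in exI) auto

lemma regular_star: "regular S A \<Longrightarrow> regular S (star A)"
  unfolding regular_def star_def by (elim exE conjE, rule exI[of _ "Star _"]) auto

lemma regular_UN: "finite I \<Longrightarrow> (\<And>i. i \<in> I \<Longrightarrow> regular S (F i)) \<Longrightarrow> regular S (\<Union>i\<in>I. F i)"
  by (induction I rule: finite_induct) (auto intro: regular_empty regular_Un)

text \<open>Since \<open>A\<close> lacks the empty word, peeling a factor of \<open>A\<close> off a
  word of \<open>X\<close> shortens it, so after finitely many factors a word of \<open>B\<close> is
  reached. The other inclusion is induction on the number of factors.\<close>

lemma arden:
  assumes X: "X = conc A X \<union> B" and A: "[] \<notin> A"
  shows "X = conc (star A) B"
proof
  show "X \<subseteq> conc (star A) B"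
  proof
    fix x assume "x \<in> X"
    then show "x \<in> conc (star A) B"
    proof (induction x rule: length_induct)
      case (1 x)
      then consider "x \<in> B" | "x \<in> conc A X"
        using X by auto
      then show ?case
      proof cases
        case 1
        have "[] @ x \<in> conc (star A) B"
          by (rule concI) (use 1 in \<open>auto simp: star_def intro: exI[of _ "[]"]\<close>)
        then show ?thesis by simp
      next
        case 2
        then obtain a y where ay: "x = a @ y" "a \<in> A" "y \<in> X"
          by (rule concE)
        with A have "length y < length x" by (cases a) auto
        with 1 ay have "y \<in> conc (star A) B" by blast
        then obtain ws b where "y = concat ws @ b" "set ws \<subseteq> A" "b \<in> B"
          by (auto simp: star_def elim!: concE)
        then have "x = concat (a # ws) @ b" "set (a # ws) \<subseteq> A"
          using ay by auto
        then show ?thesis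
          using \<open>b \<in> B\<close> unfolding star_def conc_def by blast
      qed
    qed
  qed
next
  have "concat ws @ b \<in> X" if "set ws \<subseteq> A" "b \<in> B" for ws b
    using that
  proof (induction ws)
    case Nil
    then show ?case using X by auto
  next
    case (Cons a ws)
    then have "a @ (concat ws @ b) \<in> conc A X" by (auto intro!: concI)
    then show ?case using X by auto
  qed
  then show "conc (star A) B \<subseteq> X"
    by (auto simp: star_def conc_def)
qed

text \<open>Gaussian elimination: Arden's rule solves the equation of one unknown, and substituting
  the solution leaves a system over the remaining indices. The new coefficients still avoid the
  empty word because each added product begins with a nonempty factor from
  \<open>A i k\<close>.\<close>

lemma regular_solution:
  assumes "finite I"
    and "\<And>i j. i \<in> I \<Longrightarrow> j \<in> I \<Longrightarrow> regular S (A i j) \<and> [] \<notin> A i j"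
    and "\<And>i. i \<in> I \<Longrightarrow> regular S (B i)"
    and "\<And>i. i \<in> I \<Longrightarrow> X i = (\<Union>j\<in>I. conc (A i j) (X j)) \<union> B i"
  shows "\<forall>i\<in>I. regular S (X i)"
  using assms
proof (induction I arbitrary: A B rule: finite_induct)
  case empty
  then show ?case by simp
next
  case (insert k I)
  let ?C = "star (A k k)"
  let ?A = "\<lambda>i j. A i j \<union> conc (A i k) (conc ?C (A k j))"
  let ?B = "\<lambda>i. B i \<union> conc (A i k) (conc ?C (B k))"
  have Xk: "X k = conc ?C ((\<Union>j\<in>I. conc (A k j) (X j)) \<union> B k)"
  proof (rule arden)
    show "X k = conc (A k k) (X k) \<union> ((\<Union>j\<in>I. conc (A k j) (X j)) \<union> B k)"
      using insert.prems(3)[of k] by auto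
    show "[] \<notin> A k k" using insert.prems(1) by blast
  qed
  have IH: "\<forall>i\<in>I. regular S (X i)"
  proof (rule insert.IH[where A = ?A and B = ?B])
    fix i j assume "i \<in> I" "j \<in> I"
    then show "regular S (?A i j) \<and> [] \<notin> ?A i j"
      using insert.prems(1) by (auto intro!: regular_Un regular_conc regular_star elim: concE)
  next
    fix i assume "i \<in> I"
    then show "regular S (?B i)"
      using insert.prems(1,2) by (auto intro!: regular_Un regular_conc regular_star)
  next
    fix i assume i: "i \<in> I"
    then have "X i = (\<Union>j\<in>I. conc (A i j) (X j)) \<union> conc (A i k) (X k) \<union> B i"
      using insert.prems(3)[of i] by auto
    also have "conc (A i k) (X k) =
        (\<Union>j\<in>I. conc (conc (A i k) (conc ?C (A k j))) (X j)) \<union> conc (A i k) (conc ?C (B k))"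
      by (subst Xk) (simp add: conc_Un_right conc_UN_right conc_assoc)
    finally show "X i = (\<Union>j\<in>I. conc (?A i j) (X j)) \<union> ?B i"
      by (auto simp: conc_Un_left)
  qed
  have "regular S (X k)"
    using insert.hyps insert.prems(1,2) IH
    by (subst Xk) (intro regular_conc regular_star regular_Un regular_UN; auto)
  with IH show ?case by blast
qed

text \<open>Also known as the Brzozowski derivative of \<open>L\<close> by the word
  \<open>u\<close>.\<close>

definition lquot :: "'a list \<Rightarrow> 'a list set \<Rightarrow> 'a list set" where
  "lquot u L = {w. u @ w \<in> L}"

lemma lquot_Nil: "lquot [] L = L"
  and lquot_append: "lquot (u @ v) L = lquot v (lquot u L)"
  by (auto simp: lquot_def)

text \<open>The Myhill-Nerode argument: the left quotients are the states of an automaton for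
  \<open>L\<close>, and each state satisfies a linear equation read off from its outgoing
  letters.\<close>

lemma regular_if_finite_lquots:
  assumes S: "finite S" and L: "L \<subseteq> lists S" and fin: "finite ((\<lambda>u. lquot u L) ` lists S)"
  shows "regular S L"
proof -
  let ?I = "(\<lambda>u. lquot u L) ` lists S"
  \<comment> \<open>\<open>?A M N\<close> collects the letters leading from state \<open>M\<close>
    to state \<open>N\<close>; \<open>?B M\<close> contributes the empty word exactly at accepting
    states.\<close>
  let ?A = "\<lambda>M N. \<Union>a\<in>{a \<in> S. lquot [a] M = N}. {[a]}"
  let ?B = "\<lambda>M. if [] \<in> M then {[]} else {}"
  have "\<forall>M\<in>?I. regular S M"
  proof (rule regular_solution[OF fin, where A = ?A and B = ?B])
    fix M N
    show "regular S (?A M N) \<and> [] \<notin> ?A M N"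
      using S by (auto intro!: regular_UN regular_letter)
  next
    fix M :: "'a list set"
    show "regular S (?B M)" by (simp add: regular_Nil regular_empty)
  next
    fix M assume "M \<in> ?I"
    then obtain u where u: "u \<in> lists S" "M = lquot u L" by blast
    show "M = (\<Union>N\<in>?I. conc (?A M N) N) \<union> ?B M"
    proof (intro set_eqI)
      fix w
      show "w \<in> M \<longleftrightarrow> w \<in> (\<Union>N\<in>?I. conc (?A M N) N) \<union> ?B M"
      proof (cases w)
        case Nil
        then show ?thesis by (auto simp: conc_def)
      next
        case (Cons a v)
        have "w \<in> conc (?A M N) N \<longleftrightarrow> a \<in> S \<and> lquot [a] M = N \<and> v \<in> N" for N
          unfolding Cons Cons_in_conc_letters by simp
        then have "w \<in> (\<Union>N\<in>?I. conc (?A M N) N) \<longleftrightarrow> a \<in> S \<and> lquot [a] M \<in> ?I \<and> v \<in> lquot [a] M"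
          by blast
        moreover have "a \<in> S" if "w \<in> M"
          using that Cons u L by (auto simp: lquot_def)
        moreover have "lquot [a] M \<in> ?I" if "a \<in> S"
          using that u by (auto simp: lquot_append[symmetric] intro!: imageI)
        ultimately show ?thesis
          using Cons by (auto simp: lquot_def)
      qed
    qed
  qed
  moreover have "L \<in> ?I"
    by (rule image_eqI[of _ _ "[]"]) (auto simp: lquot_Nil)
  ultimately show ?thesis by blast
qed

lemma finite_image_factor:
  assumes "finite (g ` A)" and "\<And>x y. x \<in> A \<Longrightarrow> y \<in> A \<Longrightarrow> g x = g y \<Longrightarrow> f x = f y"
  shows "finite (f ` A)"
proof -
  have "f ` A \<subseteq> (\<lambda>z. f (inv_into A g z)) ` (g ` A)"
  proof
    fix y assume "y \<in> f ` A"
    then obtain x where x: "x \<in> A" "y = f x" by blast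
    then have "f (inv_into A g (g x)) = f x"
      by (intro assms(2)) (auto simp: inv_into_into f_inv_into_f)
    with x show "y \<in> (\<lambda>z. f (inv_into A g z)) ` (g ` A)" by (metis image_eqI)
  qed
  then show ?thesis using assms(1) finite_surj by blast
qed


section \<open>Terms and their classes\<close>

lemma map_Inr_appendD: "map Inr p @ w = map Inr r \<Longrightarrow> \<exists>q. r = p @ q \<and> w = map Inr q"
proof (induction p arbitrary: r)
  case (Cons b p)
  then show ?case by (cases r) auto
qed simp

locale kan_pres =
  fixes P :: "('o, 'a, 'c, 'b, 'x) kan_pres"
  assumes pres: "kan_presentation P"
begin

sublocale D: wf_digraph "Del P"
  using pres by (simp add: kan_presentation_def)

sublocale G: wf_digraph "Gam P"
  using pres by (simp add: kan_presentation_def)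

lemma Fob_in_verts: "A \<in> verts (Gam P) \<Longrightarrow> Fob P A \<in> verts (Del P)"
  using pres by (simp add: kan_presentation_def)

lemma RelB_D:
  assumes "(l, r) \<in> RelB P"
  shows "l \<in> free_arrows (Del P)" "r \<in> free_arrows (Del P)" "src l = src r" "tgt l = tgt r"
  using assms pres by (auto simp: kan_presentation_def)

lemma free_arrows_iff: "p \<in> free_arrows (Del P) \<longleftrightarrow> D.awalk (src p) (arr_path p) (tgt p)"
  by (cases p) (auto simp: free_arrows_def)

text \<open>A walk is determined by its start and its arcs, so the vertex reached after
  \<open>p\<close> can only be \<open>C\<close>.\<close>

lemma awalk_split:
  assumes "D.awalk B p C" "D.awalk B (p @ q) E" shows "D.awalk C q E"
  using assms D.awalk_append_iff[of B p q E] D.awlast_of_awalk by auto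

lemma tau_kterm: "D.awalk (Fob P A) p B \<Longrightarrow> tau P (kterm A x p) = B"
  by (cases "p = []")
    (auto simp: tau_def kterm_def D.awalk_def last_map D.awalk_verts_conv dest: D.awlast_if_cas)

lemma terms_at_kterm:
  "A \<in> verts (Gam P) \<Longrightarrow> x \<in> Xob P A \<Longrightarrow> D.awalk (Fob P A) p B \<Longrightarrow> kterm A x p \<in> terms_at P B"
  by (auto simp: terms_at_def terms_def tau_kterm)

lemma terms_atE:
  assumes "t \<in> terms_at P B"
  obtains A x p where "t = kterm A x p" "A \<in> verts (Gam P)" "x \<in> Xob P A" "D.awalk (Fob P A) p B"
proof -
  from assms obtain A x p C where *: "t = kterm A x p" "A \<in> verts (Gam P)" "x \<in> Xob P A"
      "D.awalk (Fob P A) p C" "tau P t = B"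
    by (auto simp: terms_at_def terms_def)
  moreover have "C = B" using tau_kterm[OF *(4)] * by simp
  ultimately show thesis using that by blast
qed

lemma terms_iff: "t \<in> terms P \<longleftrightarrow> t \<in> terms_at P (tau P t)"
  by (auto simp: terms_at_def)

lemma tact_kterm: "tact (kterm A x p) q = kterm A x (p @ q)"
  by (simp add: tact_def kterm_def)

lemma tact_append: "tact (tact t p) q = tact t (p @ q)"
  by (simp add: tact_def)

lemma tact_terms_at:
  assumes "t \<in> terms_at P B" "D.awalk B q C" shows "tact t q \<in> terms_at P C"
proof -
  from assms(1) obtain A x p where *: "t = kterm A x p" "A \<in> verts (Gam P)" "x \<in> Xob P A"
      "D.awalk (Fob P A) p B"
    by (rule terms_atE)
  then show ?thesis
    using D.awalk_appendI[OF *(4) assms(2)] by (simp add: tact_kterm terms_at_kterm)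
qed

lemma Xact_Fpath:
  assumes "G.awalk A1 a A2"
  shows "D.awalk (Fob P A1) (Fpath P a) (Fob P A2)" "x \<in> Xob P A1 \<Longrightarrow> Xact P x a \<in> Xob P A2"
proof -
  have "D.awalk (Fob P A1) (Fpath P a) (Fob P A2) \<and> (x \<in> Xob P A1 \<longrightarrow> Xact P x a \<in> Xob P A2)"
    using assms
  proof (induction a arbitrary: A1 x)
    case Nil
    then show ?case
      by (auto simp: G.awalk_Nil_iff Fpath_def Xact_def D.awalk_Nil_iff Fob_in_verts)
  next
    case (Cons e a)
    then have e: "e \<in> arcs (Gam P)" "A1 = tail (Gam P) e" "G.awalk (head (Gam P) e) a A2"
      by (auto simp: G.awalk_Cons_iff)
    have "D.awalk (Fob P A1) (Farr P e) (Fob P (head (Gam P) e))"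
      and "x \<in> Xob P A1 \<Longrightarrow> Xarr P e x \<in> Xob P (head (Gam P) e)"
      using pres e by (auto simp: kan_presentation_def)
    then show ?case
      using Cons.IH[OF e(3)] D.awalk_appendI by (auto simp: Fpath_def Xact_def)
  qed
  then show "D.awalk (Fob P A1) (Fpath P a) (Fob P A2)"
    "x \<in> Xob P A1 \<Longrightarrow> Xact P x a \<in> Xob P A2" by auto
qed

lemma red_terms_at:
  assumes "red P R s t"
  obtains B where "s \<in> terms_at P B" "t \<in> terms_at P B"
  using assms
proof cases
  case (red_T s' t' w B)
  then show ?thesis
    using that[of B] tact_terms_at[of s' "tau P s'" w B] tact_terms_at[of t' "tau P s'" w B] terms_iff
    by auto
next
  case (red_P l r A x u w B)
  have "D.awalk (Fob P A) (u @ arr_path l @ w) B"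
    using red_P by (intro D.awalk_appendI[of _ u] D.awalk_appendI[of _ "arr_path l"])
      (auto simp: free_arrows_iff)
  moreover have "D.awalk (Fob P A) (u @ arr_path r @ w) B"
    using red_P by (intro D.awalk_appendI[of _ u] D.awalk_appendI[of _ "arr_path r"])
      (auto simp: free_arrows_iff)
  ultimately show ?thesis
    unfolding red_P(1,2) using that[of B] red_P terms_at_kterm by blast
qed

lemma terms_at_unique: "t \<in> terms_at P B \<Longrightarrow> t \<in> terms_at P C \<Longrightarrow> B = C"
  by (simp add: terms_at_def)

text \<open>The path \<open>q\<close> is absorbed into the right context of the rule. This needs the
  context to end at \<open>B\<close>, which follows because a term has only one end point.\<close>

lemma red_tact:
  assumes "red P R s t" "s \<in> terms_at P B" "D.awalk B q C"
  shows "red P R (tact s q) (tact t q)"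
  using assms(1)
proof cases
  case (red_T s' t' w E)
  then have "B = E"
    using assms(2) tact_terms_at[of s' "tau P s'" w E] terms_iff terms_at_unique by blast
  then have "D.awalk (tau P s') (w @ q) C"
    using red_T assms(3) D.awalk_appendI by blast
  with red_T show ?thesis by (simp add: tact_append red.red_T)
next
  case (red_P l r A x u w E)
  have "D.awalk (Fob P A) (u @ arr_path l @ w) E"
    using red_P by (intro D.awalk_appendI[of _ u] D.awalk_appendI[of _ "arr_path l"])
      (auto simp: free_arrows_iff)
  with red_P have "B = E"
    using assms(2) terms_at_kterm terms_at_unique by blast
  then have "D.awalk (tgt l) (w @ q) C"
    using red_P assms(3) D.awalk_appendI by blast
  with red_P show ?thesis using red.red_P[of l r R P A x u "w @ q" C] by (simp add: tact_kterm)
qed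

lemma red_same_terms_at:
  "red P R s t \<or> red P R t s \<Longrightarrow> s \<in> terms_at P B \<Longrightarrow> t \<in> terms_at P B"
  by (metis red_terms_at terms_at_unique)

lemma equiv_terms_at:
  assumes "equivclp (red P R) s t" "s \<in> terms_at P B" shows "t \<in> terms_at P B"
  using assms by (induction rule: equivclp_induct) (assumption, blast intro: red_same_terms_at)

lemma equiv_tact:
  assumes "equivclp (red P R) s t" "s \<in> terms_at P B" "D.awalk B q C"
  shows "equivclp (red P R) (tact s q) (tact t q)"
  using assms
proof (induction rule: equivclp_induct)
  case base
  then show ?case by simp
next
  case (step t u)
  then have "t \<in> terms_at P B" "u \<in> terms_at P B"
    using equiv_terms_at red_same_terms_at by blast+
  then have "red P R (tact t q) (tact u q) \<or> red P R (tact u q) (tact t q)"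
    using step red_tact by blast
  with step show ?case by (auto intro: equivclp_into_equivclp)
qed

lemma relB_step_D:
  assumes "relB_step P p q"
  shows "p \<in> free_arrows (Del P)" "q \<in> free_arrows (Del P)" "src p = src q" "tgt p = tgt q"
proof -
  from assms obtain l r B u w C where *: "(l, r) \<in> RelB P" "D.awalk B u (src l)"
      "D.awalk (tgt l) w C" "p = (B, u @ arr_path l @ w, C)" "q = (B, u @ arr_path r @ w, C)"
    by (cases rule: relB_step.cases) auto
  note lr = RelB_D[OF *(1)]
  have "D.awalk B (u @ arr_path l @ w) C"
    using * lr by (intro D.awalk_appendI[of _ u] D.awalk_appendI[of _ "arr_path l"])
      (auto simp: free_arrows_iff)
  moreover have "D.awalk B (u @ arr_path r @ w) C"
    using * lr by (intro D.awalk_appendI[of _ u] D.awalk_appendI[of _ "arr_path r"])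
      (auto simp: free_arrows_iff)
  ultimately show "p \<in> free_arrows (Del P)" "q \<in> free_arrows (Del P)" "src p = src q" "tgt p = tgt q"
    using * by (auto simp: free_arrows_def)
qed

lemma relB_step_red:
  assumes "relB_step P p q" "t \<in> terms_at P (src p)"
  shows "red P (init_system P) (tact t (arr_path p)) (tact t (arr_path q))"
proof -
  from assms(1) obtain l r B u w C where *: "(l, r) \<in> RelB P" "D.awalk B u (src l)"
      "D.awalk (tgt l) w C" "p = (B, u @ arr_path l @ w, C)" "q = (B, u @ arr_path r @ w, C)"
    by (cases rule: relB_step.cases) auto
  from assms(2) obtain A x v where t: "t = kterm A x v" "A \<in> verts (Gam P)" "x \<in> Xob P A"
      "D.awalk (Fob P A) v (src p)"
    by (rule terms_atE)
  \<comment> \<open>The left context \<open>u\<close> of the relation joins the path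
    \<open>v\<close> of the term and becomes the left context of the reduction.\<close>
  have "D.awalk (Fob P A) (v @ u) (src l)"
    using t * by (auto intro: D.awalk_appendI)
  then have "red P (init_system P) (kterm A x ((v @ u) @ arr_path l @ w))
      (kterm A x ((v @ u) @ arr_path r @ w))"
    using * t RelB_D[OF *(1)] by (intro red.red_P[of l r]) (auto simp: init_system_def)
  with t * show ?thesis by (simp add: tact_kterm)
qed

lemma Barr_self: "p \<in> free_arrows (Del P) \<Longrightarrow> p \<in> Barr P p"
  by (simp add: Barr_def)

lemma Barr_eq: "equivclp (relB_step P) p q \<Longrightarrow> Barr P p = Barr P q"
  unfolding Barr_def by (metis equivclp_sym equivclp_trans)

lemma BarrD:
  assumes "q \<in> Barr P p"
  shows "q \<in> free_arrows (Del P)" "src q = src p" "tgt q = tgt p" "Barr P q = Barr P p"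
    "equivclp (relB_step P) p q"
proof -
  have pq: "equivclp (relB_step P) p q" and "q \<in> free_arrows (Del P)"
    using assms by (auto simp: Barr_def)
  then show "q \<in> free_arrows (Del P)" "Barr P q = Barr P p" "equivclp (relB_step P) p q"
    using Barr_eq by auto
  show "src q = src p" "tgt q = tgt p"
    using pq by (induction rule: equivclp_induct) (auto dest: relB_step_D)
qed

lemma equiv_relB_act:
  assumes "equivclp (relB_step P) p q" "t \<in> terms_at P (src p)"
  shows "equivclp (red P (init_system P)) (tact t (arr_path p)) (tact t (arr_path q))"
  using assms
proof (induction rule: equivclp_induct)
  case base
  then show ?case by simp
next
  case (step q r)
  have "src q = src p"
    using step.hyps(1) by (induction rule: equivclp_induct) (auto dest: relB_step_D)
  with step have "t \<in> terms_at P (src q)" "t \<in> terms_at P (src r)"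
    using relB_step_D(3)[of q r] relB_step_D(3)[of r q] by auto
  then have "red P (init_system P) (tact t (arr_path q)) (tact t (arr_path r)) \<or>
      red P (init_system P) (tact t (arr_path r)) (tact t (arr_path q))"
    using step.hyps(2) relB_step_red by blast
  with step show ?case by (auto intro: equivclp_into_equivclp)
qed

end

locale kan_rewriting = kan_pres P for P :: "('o, 'a, 'c, 'b, 'x) kan_pres" +
  fixes R :: "('o, 'c, 'b, 'x) rewr_sys"
  assumes rsys: "rewrite_system_for P R"
begin

abbreviation eqv where "eqv \<equiv> equivclp (red P R)"

lemma eqv_init: "eqv = equivclp (red P (init_system P))"
  using rsys by (simp add: rewrite_system_for_def)

lemma term_class_iff: "t \<in> terms P \<Longrightarrow> u \<in> term_class P R t \<longleftrightarrow> u \<in> terms P \<and> eqv t u"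
  by (simp add: term_class_def term_rel_def)

lemma term_class_eq_iff:
  "s \<in> terms P \<Longrightarrow> t \<in> terms P \<Longrightarrow> term_class P R s = term_class P R t \<longleftrightarrow> eqv s t"
  unfolding set_eq_iff term_class_iff by (metis equivclp_refl equivclp_sym equivclp_trans)

lemma terms_at_in_terms: "t \<in> terms_at P B \<Longrightarrow> t \<in> terms P"
  by (simp add: terms_at_def)

text \<open>Well-foundedness produces an irreducible reduct and confluence makes it unique, so the
  definite description in \<open>irr\<close> denotes it.\<close>

lemma irr_irreducible:
  assumes complete: "complete_system P R" and t: "t \<in> terms_at P B"
  shows "irr P R t \<in> terms_at P B" "\<nexists>u. red P R (irr P R t) u" "eqv t (irr P R t)"
proof -
  let ?nf = "\<lambda>t s. (red P R)\<^sup>*\<^sup>* t s \<and> (\<nexists>u. red P R s u)"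
  have wf: "wfp (red P R)\<inverse>\<inverse>" and conf: "confluentp (red P R)"
    using complete by (auto simp: complete_system_def)
  have "\<exists>s. ?nf t s"
    using wf
  proof (induction t rule: wfp_induct_rule)
    case (less t)
    then show ?case
      by (cases "\<exists>u. red P R t u") (auto, meson converse_rtranclp_into_rtranclp)
  qed
  then obtain s where s: "?nf t s" by blast
  have uniq: "s' = s" if s': "?nf t s'" for s'
  proof -
    obtain u where "(red P R)\<^sup>*\<^sup>* s u" "(red P R)\<^sup>*\<^sup>* s' u"
      using confluentpD[OF conf] s s' by blast
    then show ?thesis using s s' by (metis converse_rtranclpE)
  qed
  have "?nf t (irr P R t)"
    unfolding irr_def using s uniq by (rule theI[where P = "?nf t"])
  then show "\<nexists>u. red P R (irr P R t) u" "eqv t (irr P R t)"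
    by (auto intro: rtranclp_into_equivclp)
  then show "irr P R t \<in> terms_at P B" using t equiv_terms_at by blast
qed

section \<open>The functor of classes of terms, with its transformation from X\<close>

definition Quot :: "'c \<Rightarrow> ('o, 'x, 'b) letter list set set" where
  "Quot B = term_class P R ` terms_at P B"

text \<open>Taking the union over all representatives of the arrow and of the class avoids choosing
  any. By \<open>Quot_arr_class\<close> all these sets coincide.\<close>

definition Quot_arr ::
  "('c, 'b) arrow set \<Rightarrow> ('o, 'x, 'b) letter list set \<Rightarrow> ('o, 'x, 'b) letter list set" where
  "Quot_arr X c = (\<Union>p\<in>X. \<Union>t\<in>c. term_class P R (tact t (arr_path p)))"

lemma quotient_terms_at: "terms_at P B // term_rel P R = Quot B"
  by (auto simp: quotient_def Quot_def term_class_def)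

lemma Quot_arr_class:
  assumes p: "p \<in> free_arrows (Del P)" and t: "t \<in> terms_at P (src p)"
  shows "Quot_arr (Barr P p) (term_class P R t) = term_class P R (tact t (arr_path p))"
proof -
  \<comment> \<open>Two changes of representative: replacing the path uses the rules of
    \<open>RelB\<close>, replacing the term uses compatibility of the equivalence with the
    action.\<close>
  have eq: "term_class P R (tact u (arr_path q)) = term_class P R (tact t (arr_path p))"
    if "q \<in> Barr P p" "u \<in> term_class P R t" for q u
  proof -
    have tu: "eqv t u" using that t terms_at_in_terms term_class_iff by blast
    then have u: "u \<in> terms_at P (src p)" using t equiv_terms_at by blast
    have q: "D.awalk (src p) (arr_path q) (tgt p)"
      using BarrD(1,2,3)[OF that(1)] by (simp add: free_arrows_iff)
    have "eqv (tact t (arr_path p)) (tact t (arr_path q))"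
      using equiv_relB_act[OF BarrD(5)[OF that(1)] t] by (simp add: eqv_init)
    also have "eqv (tact t (arr_path q)) (tact u (arr_path q))"
      using equiv_tact[OF tu t q] .
    finally have "eqv (tact t (arr_path p)) (tact u (arr_path q))" .
    moreover have "tact t (arr_path p) \<in> terms P" "tact u (arr_path q) \<in> terms P"
      using tact_terms_at[OF t] tact_terms_at[OF u q] p terms_at_in_terms
      by (auto simp: free_arrows_iff)
    ultimately show ?thesis by (metis term_class_eq_iff)
  qed
  have "t \<in> term_class P R t"
    using t by (simp add: terms_at_in_terms term_class_iff)
  moreover have "Quot_arr (Barr P p) (term_class P R t) =
      (\<Union>q\<in>Barr P p. \<Union>u\<in>term_class P R t. term_class P R (tact t (arr_path p)))"
    unfolding Quot_arr_def by (intro SUP_cong refl eq)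
  ultimately show ?thesis
    using Barr_self[OF p] by auto
qed

lemma set_functor_Quot: "set_functor P Quot Quot_arr"
  unfolding set_functor_def
proof (intro conjI ballI allI impI)
  fix p assume p: "p \<in> free_arrows (Del P)"
  show "Quot_arr (Barr P p) \<in> Quot (src p) \<rightarrow> Quot (tgt p)"
    using p tact_terms_at by (auto simp: Quot_def Quot_arr_class free_arrows_iff)
next
  fix B k assume B: "B \<in> verts (Del P)" and "k \<in> Quot B"
  then obtain t where t: "t \<in> terms_at P B" "k = term_class P R t" by (auto simp: Quot_def)
  have "(B, [], B) \<in> free_arrows (Del P)" using B by (simp add: free_arrows_def D.awalk_Nil_iff)
  from Quot_arr_class[OF this] t show "Quot_arr (Barr P (B, [], B)) k = k" by (simp add: tact_def)
next
  fix B p C q E k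
  assume p: "(B, p, C) \<in> free_arrows (Del P)" and q: "(C, q, E) \<in> free_arrows (Del P)"
    and "k \<in> Quot B"
  then obtain t where t: "t \<in> terms_at P B" "k = term_class P R t" by (auto simp: Quot_def)
  have pq: "(B, p @ q, E) \<in> free_arrows (Del P)"
    using p q D.awalk_appendI by (auto simp: free_arrows_def)
  have "tact t p \<in> terms_at P C"
    using t p tact_terms_at by (auto simp: free_arrows_def)
  then show "Quot_arr (Barr P (B, p @ q, E)) k = Quot_arr (Barr P (C, q, E)) (Quot_arr (Barr P (B, p, C)) k)"
    using Quot_arr_class[OF p] Quot_arr_class[OF q] Quot_arr_class[OF pq] t by (simp add: tact_append)
qed

text \<open>Naturality is the content of the initial rule from \<open>x | Fa\<close> to
  \<open>x.a | id\<close>, whose two sides therefore have the same class.\<close>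

lemma nat_trans_Quot: "nat_trans_X P Quot Quot_arr (\<lambda>A x. term_class P R (kterm A x []))"
  unfolding nat_trans_X_def
proof (intro conjI ballI allI impI)
  fix A assume "A \<in> verts (Gam P)"
  then show "(\<lambda>x. term_class P R (kterm A x [])) \<in> Xob P A \<rightarrow> Quot (Fob P A)"
    by (auto simp: Quot_def D.awalk_Nil_iff Fob_in_verts intro!: imageI terms_at_kterm)
next
  fix A1 a A2 x assume a: "G.awalk A1 a A2" and x: "x \<in> Xob P A1"
  let ?s = "kterm A1 x (Fpath P a)" and ?t = "kterm A2 (Xact P x a) []"
  have A: "A1 \<in> verts (Gam P)" "A2 \<in> verts (Gam P)"
    using a G.awalk_hd_in_verts G.awalk_last_in_verts by auto
  note ax = Xact_Fpath(1)[OF a] Xact_Fpath(2)[OF a x]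
  have id: "D.awalk (Fob P A) [] (Fob P A)" if "A \<in> verts (Gam P)" for A
    using that by (simp add: D.awalk_Nil_iff Fob_in_verts)
  have st: "?s \<in> terms_at P (Fob P A2)" "?t \<in> terms_at P (Fob P A2)"
    using A ax x id by (auto intro: terms_at_kterm)
  \<comment> \<open>The empty action puts the bare rule into the form of \<open>red_T\<close> with
    an empty right context.\<close>
  have "red P (init_system P) (tact ?s []) (tact ?t [])"
    using st a x A id
    by (intro red.red_T[where B = "Fob P A2"]) (auto simp: init_system_def terms_at_def)
  then have "eqv ?s ?t"
    unfolding eqv_init by (simp add: tact_def r_into_equivclp)
  then have "term_class P R ?t = term_class P R ?s"
    using st terms_at_in_terms term_class_eq_iff by metis
  also have "\<dots> = Quot_arr (Barr P (Fob P A1, Fpath P a, Fob P A2)) (term_class P R (kterm A1 x []))"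
    using ax x A id[OF A(1)]
    by (subst Quot_arr_class) (auto simp: free_arrows_iff tact_kterm intro: terms_at_kterm)
  finally show "term_class P R ?t =
      Quot_arr (Barr P (Fob P A1, Fpath P a, Fob P A2)) (term_class P R (kterm A1 x []))" .
qed

end

section \<open>The identification of KB with classes of terms\<close>

locale kan_identified = kan_rewriting P R
  for P :: "('o, 'a, 'c, 'b, 'x) kan_pres" and R :: "('o, 'c, 'b, 'x) rewr_sys" +
  fixes K :: "'c \<Rightarrow> 'k set" and K' :: "('c, 'b) arrow set \<Rightarrow> 'k \<Rightarrow> 'k" and \<epsilon> :: "'o \<Rightarrow> 'x \<Rightarrow> 'k"
  assumes kan: "kan_extension TYPE(('o, 'x, 'b) letter list set) P K K' \<epsilon>"
begin

lemma functor_K: "set_functor P K K'" and nat_K: "nat_trans_X P K K' \<epsilon>"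
  using kan by (auto simp: kan_extension_def)

lemma K'_closed: "p \<in> free_arrows (Del P) \<Longrightarrow> k \<in> K (src p) \<Longrightarrow> K' (Barr P p) k \<in> K (tgt p)"
  using functor_K by (auto simp: set_functor_def)

lemma K'_id: "B \<in> verts (Del P) \<Longrightarrow> k \<in> K B \<Longrightarrow> K' (Barr P (B, [], B)) k = k"
  using functor_K by (auto simp: set_functor_def)

lemma K'_comp:
  "D.awalk B p C \<Longrightarrow> D.awalk C q E \<Longrightarrow> k \<in> K B \<Longrightarrow>
    K' (Barr P (B, p @ q, E)) k = K' (Barr P (C, q, E)) (K' (Barr P (B, p, C)) k)"
  using functor_K unfolding set_functor_def free_arrows_def by blast

lemma eps_closed: "A \<in> verts (Gam P) \<Longrightarrow> x \<in> Xob P A \<Longrightarrow> \<epsilon> A x \<in> K (Fob P A)"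
  using nat_K by (auto simp: nat_trans_X_def)

lemma eps_nat:
  "G.awalk A1 a A2 \<Longrightarrow> x \<in> Xob P A1 \<Longrightarrow>
    \<epsilon> A2 (Xact P x a) = K' (Barr P (Fob P A1, Fpath P a, Fob P A2)) (\<epsilon> A1 x)"
  using nat_K by (auto simp: nat_trans_X_def)

text \<open>This decodes a word \<open>x | p\<close> into K(p)(\<epsilon>(x)); the projections are
  meaningful only on terms.\<close>

definition val :: "('o, 'x, 'b) letter list \<Rightarrow> 'k" where
  "val t = (case projl (hd t) of (A, x) \<Rightarrow>
     K' (Barr P (Fob P A, map projr (tl t), tau P t)) (\<epsilon> A x))"

lemma val_kterm:
  "D.awalk (Fob P A) p B \<Longrightarrow> val (kterm A x p) = K' (Barr P (Fob P A, p, B)) (\<epsilon> A x)"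
  by (simp add: val_def tau_kterm) (simp add: kterm_def comp_def)

lemma val_closed: "t \<in> terms_at P B \<Longrightarrow> val t \<in> K B"
  by (erule terms_atE) (use K'_closed eps_closed in \<open>fastforce simp: val_kterm free_arrows_def\<close>)

lemma val_tact:
  assumes "t \<in> terms_at P B" "D.awalk B q C"
  shows "val (tact t q) = K' (Barr P (B, q, C)) (val t)"
proof -
  from assms(1) obtain A x p where *: "t = kterm A x p" "A \<in> verts (Gam P)" "x \<in> Xob P A"
      "D.awalk (Fob P A) p B"
    by (rule terms_atE)
  then show ?thesis
    using D.awalk_appendI[OF *(4) assms(2)] assms(2) eps_closed
    by (simp add: tact_kterm val_kterm K'_comp)
qed

lemma val_gen: "A \<in> verts (Gam P) \<Longrightarrow> x \<in> Xob P A \<Longrightarrow> val (kterm A x []) = \<epsilon> A x"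
  using K'_id eps_closed Fob_in_verts by (simp add: val_kterm D.awalk_Nil_iff)

text \<open>The term rules hold by naturality of \<epsilon>, the path rules because both paths
  represent the same arrow of the presented category. The initial system suffices, as
  \<open>R\<close> generates the same equivalence.\<close>

lemma val_red:
  assumes "red P (init_system P) s t" shows "val s = val t"
  using assms
proof cases
  case (red_T s' t' w B)
  then obtain A1 a A2 x where *: "s' = kterm A1 x (Fpath P a)" "t' = kterm A2 (Xact P x a) []"
      "G.awalk A1 a A2" "x \<in> Xob P A1"
    by (auto simp: init_system_def)
  note ax = Xact_Fpath(1)[OF *(3)] Xact_Fpath(2)[OF *(3,4)]
  have "val s' = val t'"
    using * ax eps_nat val_gen G.awalk_last_in_verts[OF *(3)] by (simp add: val_kterm)
  moreover have "val s = K' (Barr P (tau P s', w, B)) (val s')"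
    and "val t = K' (Barr P (tau P t', w, B)) (val t')"
    using red_T terms_iff by (auto intro: val_tact)
  ultimately show ?thesis using red_T by simp
next
  case (red_P l r A x u w B)
  then have lr: "(l, r) \<in> RelB P" by (simp add: init_system_def)
  have 1: "D.awalk (Fob P A) (u @ arr_path l @ w) B"
    using red_P by (intro D.awalk_appendI[of _ u] D.awalk_appendI[of _ "arr_path l"])
      (auto simp: free_arrows_iff)
  have 2: "D.awalk (Fob P A) (u @ arr_path r @ w) B"
    using red_P by (intro D.awalk_appendI[of _ u] D.awalk_appendI[of _ "arr_path r"])
      (auto simp: free_arrows_iff)
  have "relB_step P (Fob P A, u @ arr_path l @ w, B) (Fob P A, u @ arr_path r @ w, B)"
    using lr red_P by (intro relB_step.intros)
  then have "Barr P (Fob P A, u @ arr_path l @ w, B) = Barr P (Fob P A, u @ arr_path r @ w, B)"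
    by (intro Barr_eq r_into_equivclp)
  then show ?thesis
    unfolding red_P(1,2) val_kterm[OF 1] val_kterm[OF 2] by simp
qed

lemma val_eqv: "eqv s t \<Longrightarrow> val s = val t"
  unfolding eqv_init by (induction rule: equivclp_induct) (auto dest: val_red)

text \<open>The choice of a representative is harmless because \<open>val\<close> is constant on
  classes.\<close>

definition theta :: "('o, 'x, 'b) letter list set \<Rightarrow> 'k" where
  "theta c = val (SOME t. t \<in> c)"

lemma theta_class:
  assumes "t \<in> terms P" shows "theta (term_class P R t) = val t"
proof -
  have "t \<in> term_class P R t" using assms by (simp add: term_class_iff)
  then have "(SOME u. u \<in> term_class P R t) \<in> term_class P R t" by (rule someI)
  then show ?thesis unfolding theta_def using assms term_class_iff val_eqv by metis
qed

text \<open>The map \<alpha> given by the universal property sends \<open>val u\<close> back to the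
  class of \<open>u\<close>: it does so on generators, and naturality extends this along
  paths.\<close>

lemma eqv_if_val_eq:
  assumes "s \<in> terms_at P B" "t \<in> terms_at P B" "val s = val t" shows "eqv s t"
proof -
  from kan obtain \<alpha> where \<alpha>: "nat_trans_B P K K' Quot Quot_arr \<alpha>"
    "factors_through P \<epsilon> \<alpha> (\<lambda>A x. term_class P R (kterm A x []))"
    unfolding kan_extension_def using set_functor_Quot nat_trans_Quot by metis
  have inv: "\<alpha> B (val u) = term_class P R u" if "u \<in> terms_at P B" for u
    using that
  proof (rule terms_atE)
    fix A x p assume u: "u = kterm A x p" "A \<in> verts (Gam P)" "x \<in> Xob P A" "D.awalk (Fob P A) p B"
    have p: "(Fob P A, p, B) \<in> free_arrows (Del P)" using u by (simp add: free_arrows_def)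
    have "\<alpha> B (val u) = Quot_arr (Barr P (Fob P A, p, B)) (\<alpha> (Fob P A) (\<epsilon> A x))"
      using \<alpha>(1) p u eps_closed[OF u(2,3)] by (fastforce simp: nat_trans_B_def val_kterm)
    also have "\<alpha> (Fob P A) (\<epsilon> A x) = term_class P R (kterm A x [])"
      using \<alpha>(2) u by (simp add: factors_through_def)
    also have "Quot_arr (Barr P (Fob P A, p, B)) \<dots> = term_class P R u"
      using Quot_arr_class[OF p] u Fob_in_verts
      by (simp add: tact_kterm terms_at_kterm D.awalk_Nil_iff)
    finally show ?thesis .
  qed
  then show ?thesis
    using assms terms_at_in_terms term_class_eq_iff by metis
qed

text \<open>
  Surjectivity: \<open>chi J\<close> is the classifying map of a family of subsets J, sending k to the sieve of
  all arrows that carry k into J. Sieves are encoded as sets of words because the universal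
  property is only available for functors with values in sets of words. If J is the range of
  the identification, then the classifying maps of J and of the whole functor agree on the
  image of \<open>\<epsilon>\<close>, hence everywhere.
\<close>

definition chi :: "('c \<Rightarrow> 'k set) \<Rightarrow> 'c \<Rightarrow> 'k \<Rightarrow> ('o, 'x, 'b) letter list set" where
  "chi J B k = {map Inr q | q C. D.awalk B q C \<and> K' (Barr P (B, q, C)) k \<in> J C}"

definition Sieve :: "'c \<Rightarrow> ('o, 'x, 'b) letter list set set" where
  "Sieve B = {chi J B k | J k. k \<in> K B}"

definition Sieve_arr ::
  "('c, 'b) arrow set \<Rightarrow> ('o, 'x, 'b) letter list set \<Rightarrow> ('o, 'x, 'b) letter list set" where
  "Sieve_arr X s = {w. \<exists>p\<in>X. map Inr (arr_path p) @ w \<in> s}"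

text \<open>A path \<open>r'\<close> carries K(p)(k) into \<open>J\<close> exactly when
  \<open>p\<close> followed by \<open>r'\<close> carries \<open>k\<close> there. Any representative
  of the arrow serves equally well.\<close>

lemma Sieve_arr_chi:
  assumes p: "p \<in> free_arrows (Del P)" and k: "k \<in> K (src p)"
  shows "Sieve_arr (Barr P p) (chi J (src p) k) = chi J (tgt p) (K' (Barr P p) k)"
proof (intro set_eqI iffI)
  fix w assume "w \<in> Sieve_arr (Barr P p) (chi J (src p) k)"
  then obtain q r C where q: "q \<in> Barr P p" and r: "map Inr (arr_path q) @ w = map Inr r"
    "D.awalk (src p) r C" "K' (Barr P (src p, r, C)) k \<in> J C"
    unfolding Sieve_arr_def chi_def by blast
  then obtain r' where r': "r = arr_path q @ r'" "w = map Inr r'"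
    using map_Inr_appendD[OF r(1)] by blast
  have qw: "D.awalk (src p) (arr_path q) (tgt p)" and qp: "(src p, arr_path q, tgt p) = q"
    using BarrD(1,2,3)[OF q] by (auto simp: free_arrows_iff prod_eq_iff)
  have r'w: "D.awalk (tgt p) r' C"
    using awalk_split[OF qw] r(2) r' by simp
  have "K' (Barr P (src p, r, C)) k = K' (Barr P (tgt p, r', C)) (K' (Barr P p) k)"
    using K'_comp[OF qw r'w k] r' BarrD(4)[OF q] qp by simp
  then show "w \<in> chi J (tgt p) (K' (Barr P p) k)"
    using r(3) r'w r' unfolding chi_def by auto
next
  fix w assume "w \<in> chi J (tgt p) (K' (Barr P p) k)"
  then obtain q C where q: "w = map Inr q" "D.awalk (tgt p) q C"
    "K' (Barr P (tgt p, q, C)) (K' (Barr P p) k) \<in> J C"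
    unfolding chi_def by blast
  have pw: "D.awalk (src p) (arr_path p) (tgt p)" using p by (simp add: free_arrows_iff)
  have "K' (Barr P (src p, arr_path p @ q, C)) k \<in> J C"
    using K'_comp[OF pw q(2) k] q(3) by simp
  then have "map Inr (arr_path p @ q) \<in> chi J (src p) k"
    using D.awalk_appendI[OF pw q(2)] unfolding chi_def by blast
  then show "w \<in> Sieve_arr (Barr P p) (chi J (src p) k)"
    using q(1) Barr_self[OF p] unfolding Sieve_arr_def by auto
qed

lemma set_functor_Sieve: "set_functor P Sieve Sieve_arr"
  unfolding set_functor_def
proof (intro conjI ballI allI impI)
  fix p assume p: "p \<in> free_arrows (Del P)"
  show "Sieve_arr (Barr P p) \<in> Sieve (src p) \<rightarrow> Sieve (tgt p)"
    using K'_closed[OF p] by (fastforce simp: Sieve_def Sieve_arr_chi[OF p])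
next
  fix B s assume B: "B \<in> verts (Del P)" and "s \<in> Sieve B"
  then obtain J k where k: "s = chi J B k" "k \<in> K B" by (auto simp: Sieve_def)
  have "(B, [], B) \<in> free_arrows (Del P)" using B by (simp add: free_arrows_def D.awalk_Nil_iff)
  from Sieve_arr_chi[OF this] k B show "Sieve_arr (Barr P (B, [], B)) s = s" by (simp add: K'_id)
next
  fix B p C q E s
  assume p: "(B, p, C) \<in> free_arrows (Del P)" and q: "(C, q, E) \<in> free_arrows (Del P)"
    and "s \<in> Sieve B"
  then obtain J k where k: "s = chi J B k" "k \<in> K B" by (auto simp: Sieve_def)
  have pq: "(B, p @ q, E) \<in> free_arrows (Del P)"
    using p q D.awalk_appendI by (auto simp: free_arrows_def)
  have "K' (Barr P (B, p, C)) k \<in> K C" using K'_closed[OF p] k by simp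
  then show "Sieve_arr (Barr P (B, p @ q, E)) s = Sieve_arr (Barr P (C, q, E)) (Sieve_arr (Barr P (B, p, C)) s)"
    using Sieve_arr_chi[OF p] Sieve_arr_chi[OF q] Sieve_arr_chi[OF pq] k p q
    by (simp add: K'_comp free_arrows_def)
qed

lemma nat_trans_chi: "nat_trans_B P K K' Sieve Sieve_arr (chi J)"
  by (auto simp: nat_trans_B_def Sieve_arr_chi) (auto simp: Sieve_def)

lemma val_surj:
  assumes B: "B \<in> verts (Del P)" and k: "k \<in> K B"
  obtains t where "t \<in> terms_at P B" "val t = k"
proof -
  let ?I = "\<lambda>C. val ` terms_at P C" and ?U = "\<lambda>C. UNIV"
  let ?\<eta> = "\<lambda>A x. chi ?U (Fob P A) (\<epsilon> A x)"
  have \<eta>: "nat_trans_X P Sieve Sieve_arr ?\<eta>"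
    unfolding nat_trans_X_def
  proof (intro conjI ballI allI impI)
    fix A assume "A \<in> verts (Gam P)"
    then show "?\<eta> A \<in> Xob P A \<rightarrow> Sieve (Fob P A)"
      using eps_closed by (auto simp: Sieve_def)
  next
    fix A1 a A2 x assume a: "G.awalk A1 a A2" and x: "x \<in> Xob P A1"
    have "(Fob P A1, Fpath P a, Fob P A2) \<in> free_arrows (Del P)"
      using Xact_Fpath[OF a] by (simp add: free_arrows_def)
    from Sieve_arr_chi[OF this] a x eps_closed G.awalk_hd_in_verts[OF a]
    show "?\<eta> A2 (Xact P x a) = Sieve_arr (Barr P (Fob P A1, Fpath P a, Fob P A2)) (?\<eta> A1 x)"
      by (simp add: eps_nat)
  qed
  \<comment> \<open>Every arrow sends \<epsilon>(x) to the value of a term, so on generators both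
    sieves contain all paths.\<close>
  have "chi ?I (Fob P A) (\<epsilon> A x) = chi ?U (Fob P A) (\<epsilon> A x)"
    if Ax: "A \<in> verts (Gam P)" "x \<in> Xob P A" for A x
  proof -
    have "K' (Barr P (Fob P A, q, C)) (\<epsilon> A x) \<in> ?I C" if "D.awalk (Fob P A) q C" for q C
      using that Ax by (auto simp: val_kterm[symmetric] intro!: imageI terms_at_kterm)
    then show ?thesis unfolding chi_def by blast
  qed
  then have "factors_through P \<epsilon> (chi ?I) ?\<eta>" "factors_through P \<epsilon> (chi ?U) ?\<eta>"
    by (auto simp: factors_through_def)
  moreover have "\<forall>\<alpha> \<alpha>'. nat_trans_B P K K' Sieve Sieve_arr \<alpha> \<and> factors_through P \<epsilon> \<alpha> ?\<eta> \<and>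
      nat_trans_B P K K' Sieve Sieve_arr \<alpha>' \<and> factors_through P \<epsilon> \<alpha>' ?\<eta> \<longrightarrow>
      (\<forall>B \<in> verts (Del P). \<forall>k \<in> K B. \<alpha> B k = \<alpha>' B k)"
    using kan set_functor_Sieve \<eta> unfolding kan_extension_def by blast
  ultimately have "chi ?I B k = chi ?U B k"
    using nat_trans_chi B k by blast
  \<comment> \<open>The identity path tests \<open>k\<close> itself: membership in the sieve for
    \<open>?I\<close> says that \<open>k\<close> is the value of a term.\<close>
  moreover have "[] \<in> chi ?U B k"
    using B by (auto simp: chi_def D.awalk_Nil_iff)
  ultimately have "[] \<in> chi ?I B k" by simp
  then have "k \<in> ?I B"
    using B k by (auto simp: chi_def D.awalk_Nil_iff K'_id)
  then show thesis using that by blast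
qed

lemma kan_identification_theta: "kan_identification P R K K' \<epsilon> theta"
  unfolding kan_identification_def
proof (intro conjI ballI allI impI)
  fix B assume B: "B \<in> verts (Del P)"
  show "bij_betw theta (terms_at P B // term_rel P R) (K B)"
    unfolding quotient_terms_at bij_betw_def
  proof
    show "inj_on theta (Quot B)"
    proof (rule inj_onI)
      fix c d assume "c \<in> Quot B" "d \<in> Quot B" "theta c = theta d"
      then obtain s t where st: "s \<in> terms_at P B" "t \<in> terms_at P B"
        "c = term_class P R s" "d = term_class P R t" "val s = val t"
        by (auto simp: Quot_def theta_class terms_at_in_terms)
      then show "c = d"
        using eqv_if_val_eq[OF st(1,2,5)] by (simp add: terms_at_in_terms term_class_eq_iff)
    qed
    show "theta ` Quot B = K B"
    proof
      show "theta ` Quot B \<subseteq> K B"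
        using val_closed by (auto simp: Quot_def theta_class terms_at_in_terms)
      show "K B \<subseteq> theta ` Quot B"
      proof
        fix k assume "k \<in> K B"
        then obtain t where t: "t \<in> terms_at P B" "val t = k"
          using val_surj[OF B] by blast
        then have "k = theta (term_class P R t)" by (simp add: theta_class terms_at_in_terms)
        with t show "k \<in> theta ` Quot B" by (auto simp: Quot_def)
      qed
    qed
  qed
next
  fix A x p B assume "A \<in> verts (Gam P)" "x \<in> Xob P A" "D.awalk (Fob P A) p B"
  then show "theta (term_class P R (kterm A x p)) = K' (Barr P (Fob P A, p, B)) (\<epsilon> A x)"
    by (simp add: theta_class terms_at_in_terms[OF terms_at_kterm] val_kterm)
qed

end


section \<open>The language of irreducible terms\<close>

text \<open>An occurrence of \<open>l\<close> not inside \<open>u\<close> lies in \<open>w\<close>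
  or straddles the boundary. In the second case its left part has at most \<open>n\<close> letters,
  so it lies in the end that \<open>u\<close> shares with \<open>v\<close>.\<close>

lemma sublist_append_same_suffix:
  assumes "sublist l (u @ w)" "\<not> sublist l u" "length l \<le> n"
    and "n \<le> length v" "drop (length u - n) u = drop (length v - n) v"
  shows "sublist l (v @ w)"
proof -
  consider "sublist l w" | l1 l2 where "l = l1 @ l2" "suffix l1 u" "prefix l2 w"
    using assms(1,2) by (auto simp: sublist_append)
  then show ?thesis
  proof cases
    case 1
    then show ?thesis by (simp add: sublist_append)
  next
    case 2
    have "suffix l1 (drop (length u - n) u)"
      using 2 assms(3) suffix_length_le[OF 2(2)]
      by (intro suffix_length_suffix[OF 2(2) suffix_drop]) auto
    then have "suffix l1 v"
      unfolding assms(5) using suffix_drop suffix_order.trans by blast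
    with 2 show ?thesis by (auto simp: sublist_append)
  qed
qed

locale kan_finite_rewriting = kan_rewriting P R
  for P :: "('o, 'a, 'c, 'b, 'x) kan_pres" and R :: "('o, 'c, 'b, 'x) rewr_sys" +
  fixes ord :: "('o, 'x, 'b) letter rel"
  assumes fin_Gam: "fin_digraph (Gam P)" and fin_Del: "fin_digraph (Del P)"
    and fin_X: "\<forall>A \<in> verts (Gam P). finite (Xob P A)"
    and fin_R: "finite_system R"
    and short_lex: "short_lex_reducing ord R"
begin

lemma finite_alphabet: "finite (alphabet P)"
proof -
  have "finite (verts (Gam P))" "finite (arcs (Del P))"
    using fin_Gam fin_Del by (auto simp: fin_digraph.finite_verts fin_digraph.finite_arcs)
  then show ?thesis
    unfolding alphabet_def using fin_X by (intro finite_Plus finite_SigmaI) auto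
qed

lemma terms_at_lists: "terms_at P B \<subseteq> lists (alphabet P)"
  by (auto elim!: terms_atE simp: kterm_def alphabet_def D.awalk_def)

definition irred_terms :: "'c \<Rightarrow> ('o, 'x, 'b) letter list set" where
  "irred_terms B = {t \<in> terms_at P B. \<nexists>u. red P R t u}"

text \<open>Rules whose sides have different end points never fire in \<open>red\<close>, so they
  must not count as redexes; \<open>lhs_P\<close> filters likewise.\<close>

definition lhs_T :: "('o, 'x, 'b) letter list set" where
  "lhs_T = {s. \<exists>t. (s, t) \<in> fst R \<and> tau P s = tau P t}"

definition lhs_P :: "('o, 'x, 'b) letter list set" where
  "lhs_P = {map Inr (arr_path l) | l r. (l, r) \<in> snd R \<and> src l = src r \<and> tgt l = tgt r}"

text \<open>Nothing lies below the empty word in short-lex order.\<close>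

lemma lhs_P_not_Nil: "l \<in> lhs_P \<Longrightarrow> l \<noteq> []"
  using short_lex by (fastforce simp: lhs_P_def short_lex_reducing_def)

lemma lhs_bounded:
  obtains n where "1 \<le> n" "\<And>l. l \<in> lhs_T \<union> lhs_P \<Longrightarrow> length l \<le> n"
proof -
  have "lhs_T \<subseteq> fst ` fst R" "lhs_P \<subseteq> (\<lambda>(l, r). map Inr (arr_path l)) ` snd R"
    by (force simp: lhs_T_def lhs_P_def)+
  then have "finite (lhs_T \<union> lhs_P)"
    using fin_R by (auto simp: finite_system_def intro: finite_subset)
  then obtain n where "\<forall>m\<in>length ` (lhs_T \<union> lhs_P). m \<le> n"
    using finite_nat_set_iff_bounded_le by blast
  \<comment> \<open>The successor makes the bound positive, so that the last \<open>n\<close>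
    letters include the letter from which \<open>tau\<close> is read.\<close>
  then have "length l \<le> Suc n" if "l \<in> lhs_T \<union> lhs_P" for l
    using that by (meson image_eqI le_SucI)
  then show thesis using that[of "Suc n"] by simp
qed

text \<open>A nonempty prefix contains the leading element of some XA, so it is itself a term, and
  what follows consists of arcs only.\<close>

lemma terms_at_appendE:
  assumes "u @ w \<in> terms_at P B" "u \<noteq> []"
  obtains q where "w = map Inr q" "u \<in> terms_at P (tau P u)" "D.awalk (tau P u) q B"
proof -
  from assms(1) obtain A x p where t: "u @ w = kterm A x p" "A \<in> verts (Gam P)" "x \<in> Xob P A"
      "D.awalk (Fob P A) p B"
    by (rule terms_atE)
  from assms(2) t(1) obtain u' where "u = Inl (A, x) # u'" "u' @ w = map Inr p"
    by (cases u) (auto simp: kterm_def)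
  then obtain r q where pq: "p = r @ q" "u = kterm A x r" "w = map Inr q"
    by (auto simp: append_eq_map_conv kterm_def)
  then have r: "D.awalk (Fob P A) r (last (D.awalk_verts (Fob P A) r))"
    and q: "D.awalk (last (D.awalk_verts (Fob P A) r)) q B"
    using t by auto
  show thesis
    using that[of q] pq q terms_at_kterm[OF t(2,3) r] tau_kterm[OF r] by simp
qed

lemma red_T_if_prefix:
  assumes t: "t \<in> terms_at P B" and s: "s \<in> lhs_T" "prefix s t"
  shows "\<exists>u. red P R t u"
proof -
  obtain s' where s': "(s, s') \<in> fst R" "tau P s = tau P s'"
    using s by (auto simp: lhs_T_def)
  have terms: "s \<in> terms P" "s' \<in> terms P"
    using s' rsys by (auto simp: rewrite_system_for_def rewrite_system_def)
  obtain w where w: "t = s @ w" using s by (auto simp: prefix_def)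
  have "s \<noteq> []" using terms by (auto simp: terms_def kterm_def)
  with t w obtain q where "w = map Inr q" "D.awalk (tau P s) q B"
    using terms_at_appendE by blast
  with red.red_T[of s s' R P q B] s' terms w show ?thesis
    by (auto simp: tact_def)
qed

lemma red_P_if_sublist:
  assumes t: "t \<in> terms_at P B" and l: "l \<in> lhs_P" "sublist l t"
  shows "\<exists>u. red P R t u"
proof -
  obtain l' r where lr: "(l', r) \<in> snd R" "src l' = src r" "tgt l' = tgt r"
    "l = map Inr (arr_path l')"
    using l by (auto simp: lhs_P_def)
  then have ne: "arr_path l' \<noteq> []" using l lhs_P_not_Nil by fastforce
  have free: "l' \<in> free_arrows (Del P)" "r \<in> free_arrows (Del P)"
    using lr rsys by (auto simp: rewrite_system_for_def rewrite_system_def)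
  from t obtain A x p where p: "t = kterm A x p" "A \<in> verts (Gam P)" "x \<in> Xob P A"
      "D.awalk (Fob P A) p B"
    by (rule terms_atE)
  \<comment> \<open>A term starts with a letter of the other summand, so the nonempty
    \<open>l\<close> must occur inside the path.\<close>
  have "\<not> prefix l t" using ne lr p by (cases "arr_path l'") (auto simp: kterm_def)
  then have "sublist (map Inr (arr_path l')) (map Inr p :: ('o, 'x, 'b) letter list)"
    using l lr p by (auto simp: kterm_def sublist_Cons_right)
  then obtain us ws :: "('o, 'x, 'b) letter list"
    where "map Inr p = us @ map Inr (arr_path l') @ ws"
    by (auto simp: sublist_def)
  then obtain u w where uw: "p = u @ arr_path l' @ w"
    by (auto simp: map_eq_append_conv dest!: map_Inr_appendD)
  obtain C E where CE: "D.awalk (Fob P A) u C" "D.awalk C (arr_path l') E" "D.awalk E w B"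
    using p(4) uw by auto
  \<comment> \<open>The end points are forced because the arc list is nonempty; an empty one could
    sit at any vertex.\<close>
  have "C = src l'" "E = tgt l'"
    using D.awalk_ends[OF CE(2)] free ne by (auto simp: free_arrows_iff)
  with CE red.red_P[of l' r R P A x u w B] lr free p uw show ?thesis by auto
qed

lemma lhs_if_red:
  assumes "red P R t z" shows "(\<exists>s\<in>lhs_T. prefix s t) \<or> (\<exists>l\<in>lhs_P. sublist l t)"
  using assms
proof cases
  case (red_T s t' w B)
  then have "s \<in> lhs_T" "prefix s t" by (auto simp: lhs_T_def tact_def)
  then show ?thesis by blast
next
  case (red_P l r A x u w B)
  then have "map Inr (arr_path l) \<in> lhs_P" unfolding lhs_P_def by blast
  moreover have "t = (Inl (A, x) # map Inr u) @ map Inr (arr_path l) @ map Inr w"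
    using red_P by (simp add: kterm_def)
  ultimately show ?thesis using sublist_appendI by blast
qed

text \<open>A reduction of \<open>u\<close> would extend along the remaining path to a reduction of
  the whole term.\<close>

lemma irred_terms_prefix:
  assumes "u @ w \<in> irred_terms B" "u \<noteq> []"
  shows "u \<in> irred_terms (tau P u)"
proof -
  from assms obtain q where q: "w = map Inr q" "u \<in> terms_at P (tau P u)" "D.awalk (tau P u) q B"
    by (auto simp: irred_terms_def elim: terms_at_appendE)
  have "\<not> red P R u z" for z
    using red_tact[OF _ q(2,3), of R z] assms(1) q(1) by (auto simp: irred_terms_def tact_def)
  with q(2) show ?thesis by (simp add: irred_terms_def)
qed

text \<open>
  Beyond the length of the left hand sides, the possible continuations of an irreducible term
  depend only on its last letters: they determine the end point, and every redex in the
  continuation that is not already a redex of the term starts within them.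
\<close>

lemma lquot_irred_terms_subset:
  assumes n: "1 \<le> n" "\<And>l. l \<in> lhs_T \<union> lhs_P \<Longrightarrow> length l \<le> n"
    and u: "u \<in> irred_terms C" "n < length u" and v: "v \<in> irred_terms E" "n < length v"
    and eq: "drop (length u - n) u = drop (length v - n) v"
  shows "lquot u (irred_terms B) \<subseteq> lquot v (irred_terms B)"
proof
  fix w assume "w \<in> lquot u (irred_terms B)"
  then have w: "u @ w \<in> terms_at P B" "\<nexists>z. red P R (u @ w) z"
    by (auto simp: lquot_def irred_terms_def)
  moreover have "u \<noteq> []" using u by auto
  ultimately obtain q where q: "w = map Inr q" "D.awalk (tau P u) q B"
    using terms_at_appendE by blast
  have "last u = last v"
    using n(1) u(2) v(2) arg_cong[OF eq, of last] by simp
  \<comment> \<open>Both words have at least two letters, so \<open>tau\<close> takes its branch for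
    nonempty paths and depends on the last arc alone.\<close>
  moreover have "tl u \<noteq> []" "tl v \<noteq> []"
    using n(1) u(2) v(2) by (auto simp: tl_Nil)
  ultimately have "tau P u = tau P v" by (simp add: tau_def)
  then have vw: "v @ w \<in> terms_at P B"
    using tact_terms_at[of v "tau P v" q B] q v(1)
    by (auto simp: irred_terms_def tact_def terms_at_def)
  moreover have "\<nexists>z. red P R (v @ w) z"
  proof
    assume "\<exists>z. red P R (v @ w) z"
    then consider s where "s \<in> lhs_T" "prefix s (v @ w)" | l where "l \<in> lhs_P" "sublist l (v @ w)"
      using lhs_if_red by blast
    then show False
    proof cases
      case 1
      have "length s \<le> n" using 1 n(2) by blast
      \<comment> \<open>A term rule applies only at the beginning, and \<open>v\<close> is longer
        than \<open>s\<close>, so the redex would already be in \<open>v\<close>.\<close>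
      then have "prefix s v"
        using 1(2) v(2) by (meson less_imp_le order_trans prefixI prefix_length_prefix)
      with 1 v(1) show False using red_T_if_prefix by (auto simp: irred_terms_def)
    next
      case 2
      have "\<not> sublist l v"
        using 2 v(1) red_P_if_sublist by (auto simp: irred_terms_def)
      \<comment> \<open>The redex is moved from \<open>v @ w\<close> back to \<open>u @ w\<close>,
        so the roles of \<open>u\<close> and \<open>v\<close> in the lemma are exchanged.\<close>
      then have "sublist l (u @ w)"
        using sublist_append_same_suffix[OF 2(2), of n u] n(2) 2(1) u(2) eq by simp
      with 2 w show False using red_P_if_sublist by blast
    qed
  qed
  ultimately show "w \<in> lquot v (irred_terms B)"
    by (simp add: lquot_def irred_terms_def)
qed

lemma regular_irred_terms: "regular (alphabet P) (irred_terms B)"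
proof (rule regular_if_finite_lquots[OF finite_alphabet])
  show "irred_terms B \<subseteq> lists (alphabet P)"
    using terms_at_lists by (auto simp: irred_terms_def)
  obtain n where n: "1 \<le> n" "\<And>l. l \<in> lhs_T \<union> lhs_P \<Longrightarrow> length l \<le> n"
    by (rule lhs_bounded) blast
  let ?G = "lists (alphabet P) \<inter> (\<Union>C. irred_terms C)"
  \<comment> \<open>For words of length at most \<open>n\<close> the subtraction gives 0, so nothing
    is dropped and the key contains the whole word. The flag separates these from longer words with
    the same ending.\<close>
  let ?key = "\<lambda>u. (length u \<le> n, drop (length u - n) u)"
  have "?key ` ?G \<subseteq> UNIV \<times> {w. set w \<subseteq> alphabet P \<and> length w \<le> n}"
    by (auto dest: in_set_dropD)
  then have "finite (?key ` ?G)"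
    by (rule finite_subset) (simp add: finite_lists_length_le finite_alphabet)
  then have fin: "finite ((\<lambda>u. lquot u (irred_terms B)) ` ?G)"
  proof (rule finite_image_factor)
    fix u v assume u: "u \<in> ?G" and v: "v \<in> ?G" and key: "?key u = ?key v"
    show "lquot u (irred_terms B) = lquot v (irred_terms B)"
    proof (cases "length u \<le> n")
      case True
      with key show ?thesis by simp
    next
      case False
      with key have *: "n < length u" "n < length v"
        "drop (length u - n) u = drop (length v - n) v"
        by auto
      from u v obtain C E where "u \<in> irred_terms C" "v \<in> irred_terms E" by blast
      then show ?thesis
        using * by (intro equalityI lquot_irred_terms_subset[OF n]) auto
    qed
  qed
  \<comment> \<open>Words that begin no irreducible term contribute only the empty quotient. The
    empty word is treated apart: it is not a term, yet its quotient is the whole language.\<close>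
  have "lquot u (irred_terms B) = {}" if "u \<notin> (\<Union>C. irred_terms C)" "u \<noteq> []" for u
    using that irred_terms_prefix by (auto simp: lquot_def)
  then have "(\<lambda>u. lquot u (irred_terms B)) ` lists (alphabet P) \<subseteq>
      {{}, lquot [] (irred_terms B)} \<union> (\<lambda>u. lquot u (irred_terms B)) ` ?G"
    by blast
  then show "finite ((\<lambda>u. lquot u (irred_terms B)) ` lists (alphabet P))"
    by (rule finite_subset) (use fin in simp)
qed

end

theorem theorem4p3:
  fixes P :: "('o, 'a, 'c, 'b, 'x) kan_pres"
    and K :: "'c \<Rightarrow> 'k set"
    and K' :: "('c, 'b) arrow set \<Rightarrow> 'k \<Rightarrow> 'k"
    and \<epsilon> :: "'o \<Rightarrow> 'x \<Rightarrow> 'k"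
    and R :: "('o, 'c, 'b, 'x) rewr_sys"
    and ord :: "('o, 'x, 'b) letter rel"
  assumes "kan_presentation P"
    and "kan_extension TYPE(('o, 'x, 'b) letter list set) P K K' \<epsilon>"
    and "fin_digraph (Gam P)" and "fin_digraph (Del P)"
    and "\<forall>A \<in> verts (Gam P). finite (Xob P A)"
    and "rewrite_system_for P R"
    and "finite_system R"
    and "complete_system P R"
    and "linear_order_on (alphabet P) ord"
    and "short_lex_reducing ord R"
  shows "\<exists>\<theta>. kan_identification P R K K' \<epsilon> \<theta> \<and>
    (\<exists>reg :: 'c \<Rightarrow> ('o, 'x, 'b) letter rexp.
       (\<forall>B \<in> verts (Del P).
          atoms (reg B) \<subseteq> alphabet P \<and> lang (reg B) \<subseteq> terms_at P B \<and>
          K B = \<theta> ` {term_class P R t | t. t \<in> lang (reg B)}) \<and>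
       (\<forall>b \<in> arcs (Del P). \<forall>t \<in> lang (reg (tail (Del P) b)).
          irr P R (tact t [b]) \<in> lang (reg (head (Del P) b))))"
proof -
  interpret kan_identified P R K K' \<epsilon>
    using assms by unfold_locales
  interpret kan_finite_rewriting P R ord
    using assms by (intro kan_finite_rewriting.intro kan_finite_rewriting_axioms.intro kan_rewriting_axioms)
  have "\<forall>B. \<exists>r. atoms r \<subseteq> alphabet P \<and> lang r = irred_terms B"
    using regular_irred_terms by (simp add: regular_def)
  then obtain reg where reg: "\<And>B. atoms (reg B) \<subseteq> alphabet P" "\<And>B. lang (reg B) = irred_terms B"
    by metis
  have sub: "irred_terms B \<subseteq> terms_at P B" for B
    by (auto simp: irred_terms_def)
  have irr: "irr P R t \<in> irred_terms B" if "t \<in> terms_at P B" for t B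
    using irr_irreducible[OF assms(8) that] by (simp add: irred_terms_def)
  \<comment> \<open>Passing to irreducible terms loses no class, since each term is equivalent to
    its irreducible form at the same object.\<close>
  have classes: "{term_class P R t | t. t \<in> irred_terms B} = Quot B" for B
  proof
    show "{term_class P R t | t. t \<in> irred_terms B} \<subseteq> Quot B"
      using sub by (auto simp: Quot_def)
    show "Quot B \<subseteq> {term_class P R t | t. t \<in> irred_terms B}"
    proof
      fix c assume "c \<in> Quot B"
      then obtain t where t: "t \<in> terms_at P B" "c = term_class P R t" by (auto simp: Quot_def)
      then have "c = term_class P R (irr P R t)"
        using irr_irreducible[OF assms(8) t(1)] terms_at_in_terms term_class_eq_iff by metis
      with irr[OF t(1)] show "c \<in> {term_class P R t | t. t \<in> irred_terms B}" by blast
    qed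
  qed
  have "K B = theta ` Quot B" if "B \<in> verts (Del P)" for B
    using kan_identification_theta that
    by (auto simp: kan_identification_def quotient_terms_at bij_betw_def)
  moreover have "irr P R (tact t [b]) \<in> irred_terms (head (Del P) b)"
    if "b \<in> arcs (Del P)" "t \<in> irred_terms (tail (Del P) b)" for b t
    using irr tact_terms_at sub that D.arc_implies_awalk by blast
  ultimately show ?thesis
    using kan_identification_theta reg sub classes
    by (intro exI[of _ theta] conjI exI[of _ reg]) auto
qed

end
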